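(* Let $(X,\mathcal W)$ be a balayage space satisfying the axiom of polarity. Let $\varphi\in\tilde{\mathcal B}(X)$ with $\varphi\ge0$, and let $\Psi$ denote the set of all bounded upper semicontinuous functions $\psi$ on $X$ with $0\le\psi\le\varphi$ and with compact support in $\{\varphi>0\}$. Then there exists an increasing sequence $(\psi_n)$ in $\Psi$ such that $$\hat R_\varphi=\sup_{n\in\mathbb N}\hat R_{\psi_n}.$$ In particular, $$R_\varphi=\varphi\vee\sup_{n\in\mathbb N}\hat R_{\psi_n}=\varphi\vee\sup_{n\in\mathbb N}R_{\psi_n}=\sup\{R_\psi:\psi\in\Psi\}.$$
   Context: Balayage space: $X$ is a locally compact Hausdorff space with countable base and $\mathcal W$ is a convex cone of lower semicontinuous functions $u\colon X\to[0,\infty]$ (the positive hyperharmonic functions on $X$) such that: (B1) $\sup_n v_n\in\mathcal W$ for every increasing sequence $(v_n)$ in $\mathcal W$; (B2) for every $\mathcal V\subset\mathcal W$, the lower semicontinuous regularization of $\inf\mathcal V$ with respect to the fine topology (the coarsest topology on $X$ that is at least as fine as the initial one and for which all functions in $\mathcal W$ are continuous) belongs to $\mathcal W$; (B3) if $u,v',v''\in\mathcal W$ and $u\le v'+v''$, there are $u',u''\in\mathcal W$ with $u=u'+u''$, $u'\le v'$, $u''\le v''$; (B4) for all $x\ne y$ in $X$ and $\gamma>0$ there is $u\in\mathcal W$ with $u(x)\ne\gamma u(y)$; every $w\in\mathcal W$ is the supremum of all continuous real $v\in\mathcal W$ with $v\le w$; and there are strictly positive continuous real functions $u,v\in\mathcal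 W$ such that $u/v$ tends to $0$ at infinity. "Numerical" means with values in $[-\infty,\infty]$. $\mathcal B(X)$ is the set of all numerical Borel measurable functions on $X$. Operations $\vee$ (maximum) and suprema are pointwise. For $\varphi\colon X\to[0,\infty]$, $R_\varphi:=\inf\{u\in\mathcal W: u\ge\varphi\}$ (pointwise infimum). For a numerical function $v$ on $X$, $\hat v(x):=\liminf_{y\to x}v(y)$ is its lower semicontinuous regularization (in the initial topology), and $\hat R_\varphi:=\widehat{R_\varphi}$. A set $P\subset X$ is polar if it has no interior points and, for every $x\in X$, there is $u\in\mathcal W$ with $u=\infty$ on $P\setminus\{x\}$ and $u(x)<\infty$. Axiom of polarity (Hunt's hypothesis (H)): every set $\{\hat v<v\}$, where $v=\inf\mathcal V$ for some $\mathcal V\subset\mathcal W$ (such sets are called semipolar here), is polar. $\tilde{\mathcal B}(X)$ is the set of all numerical functions $\varphi$ on $X$ for which there exist $\varphi_1,\varphi_2\in\mathcal B(X)$ with $\varphi_1\le\varphi\le\varphi_2$ on $X$ and $\varphi_1=\varphi_2$ outside a polar set. *)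

theory Defs
  imports "HOL-Analysis.Analysis"
begin

text \<open>Numerical functions on $X$ have type \<open>'a \<Rightarrow> ereal\<close>, where $X$ is the whole type; order, suprema and
  infima of such functions are the pointwise ones of the function space.\<close>

definition lower_semicontinuous :: "('a::topological_space \<Rightarrow> ereal) \<Rightarrow> bool" where
  "lower_semicontinuous f \<longleftrightarrow> (\<forall>c. open {x. c < f x})"

definition upper_semicontinuous :: "('a::topological_space \<Rightarrow> ereal) \<Rightarrow> bool" where
  "upper_semicontinuous f \<longleftrightarrow> (\<forall>c. open {x. f x < c})"

text \<open>In both regularizations below the neighbourhood filter of \<open>x\<close> is not punctured, so that the
  regularization of \<open>f\<close> is the largest lower semicontinuous minorant of \<open>f\<close>.\<close>

definition lsc_regularization :: "('a::topological_space \<Rightarrow> ereal) \<Rightarrow> 'a \<Rightarrow> ereal" where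
  "lsc_regularization f x = Liminf (nhds x) f"

definition fine_topology :: "('a::topological_space \<Rightarrow> ereal) set \<Rightarrow> 'a topology" where
  "fine_topology W = topology_generated_by ({U. open U} \<union> {u -` V |u V. u \<in> W \<and> open V})"

definition fine_lsc_regularization ::
    "('a::topological_space \<Rightarrow> ereal) set \<Rightarrow> ('a \<Rightarrow> ereal) \<Rightarrow> 'a \<Rightarrow> ereal" where
  "fine_lsc_regularization W f x = Liminf (nhdsin (fine_topology W) x) f"

definition continuous_real :: "('a::topological_space \<Rightarrow> ereal) \<Rightarrow> bool" where
  "continuous_real f \<longleftrightarrow> continuous_on UNIV f \<and> (\<forall>x. \<bar>f x\<bar> \<noteq> \<infinity>)"

text \<open>The filter of complements of compact sets expresses convergence at infinity; it is \<open>bot\<close>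
  (the condition is void) if $X$ is compact.\<close>

definition at_inf :: "'a::topological_space filter" where
  "at_inf = (INF K\<in>{K. compact K}. principal (- K))"

locale balayage_space =
  fixes W :: "('a::{t2_space, second_countable_topology} \<Rightarrow> ereal) set"
  assumes locally_compact: "locally_compact_space (euclidean :: 'a topology)"
    and nonneg: "\<And>u x. u \<in> W \<Longrightarrow> 0 \<le> u x"
    and lsc: "\<And>u. u \<in> W \<Longrightarrow> lower_semicontinuous u"
    and cone_add: "\<And>u v. u \<in> W \<Longrightarrow> v \<in> W \<Longrightarrow> (\<lambda>x. u x + v x) \<in> W"
    and cone_scale: "\<And>u (c::real). u \<in> W \<Longrightarrow> 0 \<le> c \<Longrightarrow> (\<lambda>x. ereal c * u x) \<in> W"
    and B1: "\<And>v :: nat \<Rightarrow> 'a \<Rightarrow> ereal. (\<And>n. v n \<in> W) \<Longrightarrow> incseq v \<Longrightarrow> (SUP n. v n) \<in> W"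
    and B2: "\<And>V. V \<subseteq> W \<Longrightarrow> fine_lsc_regularization W (Inf V) \<in> W"
    and B3: "\<And>u v' v''. u \<in> W \<Longrightarrow> v' \<in> W \<Longrightarrow> v'' \<in> W \<Longrightarrow> (\<And>x. u x \<le> v' x + v'' x) \<Longrightarrow>
        \<exists>u'\<in>W. \<exists>u''\<in>W. (\<forall>x. u x = u' x + u'' x) \<and> u' \<le> v' \<and> u'' \<le> v''"
    and B4_separation: "\<And>x y (\<gamma>::real). x \<noteq> y \<Longrightarrow> 0 < \<gamma> \<Longrightarrow> \<exists>u\<in>W. u x \<noteq> ereal \<gamma> * u y"
    and B4_approximation: "\<And>w. w \<in> W \<Longrightarrow> w = Sup {v \<in> W. continuous_real v \<and> v \<le> w}"
    and B4_infinity: "\<exists>u\<in>W. \<exists>v\<in>W. continuous_real u \<and> continuous_real v \<and>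
        (\<forall>x. 0 < u x) \<and> (\<forall>x. 0 < v x) \<and> ((\<lambda>x. u x / v x) \<longlongrightarrow> 0) at_inf"

definition reduite :: "('a::topological_space \<Rightarrow> ereal) set \<Rightarrow> ('a \<Rightarrow> ereal) \<Rightarrow> 'a \<Rightarrow> ereal" where
  "reduite W \<phi> = Inf {u \<in> W. \<phi> \<le> u}"

definition regularized_reduite :: "('a::topological_space \<Rightarrow> ereal) set \<Rightarrow> ('a \<Rightarrow> ereal) \<Rightarrow> 'a \<Rightarrow> ereal" where
  "regularized_reduite W \<phi> = lsc_regularization (reduite W \<phi>)"

definition polar :: "('a::topological_space \<Rightarrow> ereal) set \<Rightarrow> 'a set \<Rightarrow> bool" where
  "polar W P \<longleftrightarrow> interior P = {} \<and>
     (\<forall>x. \<exists>u\<in>W. (\<forall>y\<in>P - {x}. u y = \<infinity>) \<and> u x < \<infinity>)"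

definition semipolar :: "('a::topological_space \<Rightarrow> ereal) set \<Rightarrow> 'a set \<Rightarrow> bool" where
  "semipolar W S \<longleftrightarrow> (\<exists>V\<subseteq>W. S = {x. lsc_regularization (Inf V) x < Inf V x})"

definition axiom_of_polarity :: "('a::topological_space \<Rightarrow> ereal) set \<Rightarrow> bool" where
  "axiom_of_polarity W \<longleftrightarrow> (\<forall>S. semipolar W S \<longrightarrow> polar W S)"

definition borel_mod_polar :: "('a::topological_space \<Rightarrow> ereal) set \<Rightarrow> ('a \<Rightarrow> ereal) set" where
  "borel_mod_polar W = {\<phi>. \<exists>\<phi>1\<in>borel_measurable borel. \<exists>\<phi>2\<in>borel_measurable borel.
     \<phi>1 \<le> \<phi> \<and> \<phi> \<le> \<phi>2 \<and> (\<exists>P. polar W P \<and> (\<forall>x. x \<notin> P \<longrightarrow> \<phi>1 x = \<phi>2 x))}"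

definition usc_minorants :: "('a::topological_space \<Rightarrow> ereal) \<Rightarrow> ('a \<Rightarrow> ereal) set" where
  "usc_minorants \<phi> = {\<psi>. upper_semicontinuous \<psi> \<and> (\<exists>M::real. \<forall>x. \<psi> x \<le> ereal M) \<and>
     (\<forall>x. 0 \<le> \<psi> x) \<and> \<psi> \<le> \<phi> \<and>
     compact (closure {x. \<psi> x \<noteq> 0}) \<and> closure {x. \<psi> x \<noteq> 0} \<subseteq> {x. 0 < \<phi> x}}"

end

theory Submission
  imports Defs
begin

text \<open>Functions in \<open>W\<close> are finely continuous and polar sets have no fine interior points, so inequalities
  between functions in \<open>W\<close> need only hold off a polar set. Write \<open>r\<^sub>\<phi>\<close> for the regularization of
  \<open>R\<^sub>\<phi>\<close>. Under the axiom of polarity, \<open>R\<^sub>\<phi> = \<phi> \<squnion> r\<^sub>\<phi>\<close>, and \<open>\<phi> \<mapsto> R\<^sub>\<phi>\<close> is continuous along increasing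
  sequences; hence \<open>S \<mapsto> R(1\<^sub>S) x\<close> is a Choquet capacity, and a Borel set is polar once its compact
  subsets are. Let \<open>v\<close> be the supremum of all \<open>r\<^sub>\<psi>\<close> with \<open>\<psi> \<in> \<Psi>\<close>, a countable one by Lindelof's theorem.
  For Borel \<open>\<phi>\<close> and compact \<open>K \<subseteq> {v < q < \<phi>}\<close>, the function \<open>\<psi> = q 1\<^sub>K\<close> belongs to \<open>\<Psi>\<close>, so
  \<open>q \<le> r\<^sub>\<psi> \<le> v\<close> on \<open>K\<close> off a polar set, and \<open>K\<close> is polar. Thus \<open>\<phi> \<le> v\<close> off a polar set, whence
  \<open>r\<^sub>\<phi> \<le> v\<close>.\<close>

section \<open>Analytic sets and Choquet's capacitability theorem\<close>

text \<open>The closed set \<open>C\<close> plays the role of a Souslin scheme; countable unions and intersections then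
  reduce to re-indexing the sequence coordinate.\<close>

definition analytic :: "'a::topological_space set \<Rightarrow> bool" where
  "analytic A \<longleftrightarrow> (\<exists>C :: ('a \<times> (nat \<Rightarrow> nat)) set. closed C \<and> A = fst ` C)"

lemma closed_imp_analytic:
  assumes "closed A" shows "analytic A"
  unfolding analytic_def
  by (rule exI[of _ "A \<times> UNIV"]) (use assms in \<open>auto intro: closed_Times\<close>)

lemma continuous_on_snd_apply:
  "continuous_on UNIV (\<lambda>p :: 'a::topological_space \<times> ('i \<Rightarrow> 'b::topological_space). snd p i)"
  by (rule continuous_on_compose2[OF continuous_on_product_coordinates[of i]])
    (auto intro: continuous_intros)

lemma analytic_UN:
  fixes A :: "nat \<Rightarrow> 'a::topological_space set"
  assumes "\<And>i. analytic (A i)" shows "analytic (\<Union>i. A i)"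
proof -
  obtain C where cl: "\<And>i. closed (C i)" and A: "\<And>i. A i = fst ` (C i :: ('a \<times> (nat \<Rightarrow> nat)) set)"
    using assms unfolding analytic_def by metis
  let ?tl = "\<lambda>p :: 'a \<times> (nat \<Rightarrow> nat). (fst p, \<lambda>j. snd p (Suc j))"
  let ?hd = "\<lambda>p :: 'a \<times> (nat \<Rightarrow> nat). snd p 0"
  \<comment> \<open>The first term of the sequence chooses the index \<open>i\<close>; the shifted
    sequence witnesses membership in \<open>A i\<close>.\<close>
  define D where "D = {p. ?tl p \<in> C (?hd p)}"
  have tl: "continuous_on UNIV ?tl"
    by (intro continuous_intros continuous_on_snd_apply)
  \<comment> \<open>Where the first term is \<open>i\<close>, \<open>D\<close> agrees with a closed
    set, and these slices are open because \<open>nat\<close> is discrete.\<close>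
  have "- D = (\<Union>i. ?hd -` {i} \<inter> - (?tl -` C i))"
    by (auto simp: D_def)
  moreover have "open (?hd -` {i} \<inter> - (?tl -` C i))" for i
    by (intro open_Int open_Compl closed_vimage[OF cl tl] open_vimage continuous_on_snd_apply)
      (simp add: open_discrete)
  ultimately have "closed D"
    by (simp add: closed_def open_UN)
  moreover have "(\<Union>i. A i) = fst ` D"
  proof (intro equalityI subsetI)
    fix x assume "x \<in> (\<Union>i. A i)"
    then obtain i \<sigma> where "(x, \<sigma>) \<in> C i" by (auto simp: A)
    then have "(x, case_nat i \<sigma>) \<in> D" by (simp add: D_def)
    then show "x \<in> fst ` D" by force
  qed (force simp: D_def A)
  ultimately show ?thesis unfolding analytic_def by blast
qed

lemma analytic_INT:
  fixes A :: "nat \<Rightarrow> 'a::topological_space set"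
  assumes "\<And>i. analytic (A i)" shows "analytic (\<Inter>i. A i)"
proof -
  obtain C where cl: "\<And>i. closed (C i)" and A: "\<And>i. A i = fst ` (C i :: ('a \<times> (nat \<Rightarrow> nat)) set)"
    using assms unfolding analytic_def by metis
  let ?s = "\<lambda>i (p :: 'a \<times> (nat \<Rightarrow> nat)). (fst p, \<lambda>j. snd p (prod_encode (i, j)))"
  \<comment> \<open>The pairing function splits one sequence into countably many: the
    \<open>i\<close>-th is a witness for \<open>A i\<close>, and all share the point
    \<open>fst p\<close>.\<close>
  define D where "D = (\<Inter>i. ?s i -` C i)"
  have "continuous_on UNIV (?s i)" for i
    by (intro continuous_intros continuous_on_snd_apply)
  then have "closed D"
    unfolding D_def by (intro closed_INT ballI closed_vimage cl)
  moreover have "(\<Inter>i. A i) = fst ` D"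
  proof (intro equalityI subsetI)
    fix x assume "x \<in> (\<Inter>i. A i)"
    then have "\<forall>i. \<exists>\<sigma>. (x, \<sigma>) \<in> C i" by (force simp: A)
    then obtain \<sigma> where "\<And>i. (x, \<sigma> i) \<in> C i" by metis
    then have "(x, \<lambda>n. case prod_decode n of (i, j) \<Rightarrow> \<sigma> i j) \<in> D"
      by (simp add: D_def)
    then show "x \<in> fst ` D" by force
  qed (force simp: D_def A)
  ultimately show ?thesis unfolding analytic_def by blast
qed

lemma Lindelof_image:
  fixes G :: "'i \<Rightarrow> 'a::second_countable_topology set"
  assumes "\<And>i. i \<in> I \<Longrightarrow> open (G i)"
  obtains J where "J \<subseteq> I" "countable J" "\<Union>(G ` J) = \<Union>(G ` I)"
proof -
  obtain F where "F \<subseteq> G ` I" "countable F" "\<Union>F = \<Union>(G ` I)"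
    using Lindelof[of "G ` I"] assms by blast
  then show ?thesis using that by (metis countable_subset_image)
qed

text \<open>Compact neighbourhoods inside \<open>U\<close> cover \<open>U\<close>, and by Lindelof
  countably many of them suffice.\<close>

lemma open_eq_UN_compact:
  fixes U :: "'a::{t2_space, second_countable_topology} set"
  assumes lc: "locally_compact_space (euclidean :: 'a topology)" and "open U"
  obtains K :: "nat \<Rightarrow> 'a set" where "\<And>n. compact (K n)" "U = (\<Union>n. K n)"
proof -
  have "compactin euclidean = (compact :: 'a set \<Rightarrow> bool)" by (intro ext) simp
  then have base: "neighbourhood_base_of compact (euclidean :: 'a topology)"
    using lc locally_compact_space_neighbourhood_base[of "euclidean :: 'a topology"]
    by (simp add: Hausdorff_space_def disjnt_def separation_t2)
  have "\<exists>O' K. open O' \<and> compact K \<and> x \<in> O' \<and> O' \<subseteq> K \<and> K \<subseteq> U" if "x \<in> U" for x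
    using base that \<open>open U\<close> unfolding neighbourhood_base_of by simp
  then obtain G k where Gk: "\<And>x. x \<in> U \<Longrightarrow>
      open (G x) \<and> compact (k x) \<and> x \<in> G x \<and> G x \<subseteq> k x \<and> k x \<subseteq> U"
    by metis
  then obtain S where S: "S \<subseteq> U" "countable S" "\<Union>(G ` S) = \<Union>(G ` U)"
    using Lindelof_image[of U G] by metis
  have U: "U = (\<Union>x\<in>S. k x)"
  proof
    have "U \<subseteq> \<Union>(G ` U)" using Gk by blast
    also have "\<dots> = \<Union>(G ` S)" using S by simp
    also have "\<dots> \<subseteq> (\<Union>x\<in>S. k x)" using Gk S(1) by (intro UN_mono) auto
    finally show "U \<subseteq> (\<Union>x\<in>S. k x)" .
    show "(\<Union>x\<in>S. k x) \<subseteq> U" using Gk S(1) by blast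
  qed
  define K where "K n = (if S = {} then {} else k (from_nat_into S n))" for n
  have "compact (K n)" for n
    using Gk S(1) from_nat_into[of S n] by (auto simp: K_def)
  moreover have "U = (\<Union>n. K n)"
  proof (cases "S = {}")
    case False
    have "(\<Union>n. K n) = (\<Union>x \<in> range (from_nat_into S). k x)"
      using False by (simp add: K_def)
    also have "range (from_nat_into S) = S"
      using False S(2) by (rule range_from_nat_into)
    finally show ?thesis using U by simp
  qed (use U in \<open>simp add: K_def\<close>)
  ultimately show ?thesis by (rule that)
qed

text \<open>The complement of an analytic set need not be analytic, so the induction over the
  generated sigma-algebra carries \<open>A\<close> and \<open>- A\<close> together.\<close>

lemma borel_imp_analytic:
  fixes A :: "'a::{t2_space, second_countable_topology} set"
  assumes lc: "locally_compact_space (euclidean :: 'a topology)" and "A \<in> sets borel"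
  shows "analytic A"
proof -
  have "A \<in> sigma_sets UNIV {S. open S}"
    using assms(2) by (simp add: borel_def)
  then have "analytic A \<and> analytic (- A)"
  proof induction
    case (Basic U)
    then obtain K where "\<And>n::nat. compact (K n)" "U = (\<Union>n. K n)"
      using open_eq_UN_compact[OF lc] by blast
    moreover have "closed (- U)" using Basic by (simp add: closed_Compl)
    ultimately show ?case
      using analytic_UN[of K] by (simp add: closed_imp_analytic compact_imp_closed)
  next
    case (Union B)
    then show ?case
      using analytic_UN[of B] analytic_INT[of "\<lambda>i. - B i"] by simp
  qed (auto simp: closed_imp_analytic Compl_eq_Diff_UNIV[symmetric])
  then show ?thesis ..
qed

section \<open>Choquet's capacitability theorem\<close>

lemma compact_bounded_sequences: "compact {\<sigma> :: nat \<Rightarrow> nat. \<forall>i. \<sigma> i \<le> b i}"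
proof -
  have "compactin (product_topology (\<lambda>i::nat. euclidean::nat topology) UNIV) (PiE UNIV (\<lambda>i. {..b i}))"
    unfolding compactin_PiE by (simp add: finite_imp_compact)
  moreover have "PiE UNIV (\<lambda>i. {..b i}) = {\<sigma>. \<forall>i. \<sigma> i \<le> b i}"
    by (auto simp: PiE_def Pi_def)
  ultimately show ?thesis by (simp add: euclidean_product_topology)
qed

text \<open>The terms of the sequence coordinate are bounded one after another while
  \<open>c\<close> stays above \<open>t\<close>; together the bounds cut out a compact part of the
  closed set. The conclusion concerns open neighbourhoods of \<open>L\<close>; passing from them to
  \<open>L\<close> is left to an outer regularity argument for the particular
  \<open>c\<close>.\<close>

theorem choquet_capacitability:
  fixes c :: "'a::{t2_space, second_countable_topology} set \<Rightarrow> ereal"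
  assumes lc: "locally_compact_space (euclidean :: 'a topology)"
    and mono: "\<And>A B. A \<subseteq> B \<Longrightarrow> c A \<le> c B"
    and up: "\<And>A :: nat \<Rightarrow> 'a set. incseq A \<Longrightarrow> c (\<Union>n. A n) = (SUP n. c (A n))"
    and "analytic A" "t < c A"
  obtains L where "compact L" "L \<subseteq> A" "\<And>U. open U \<Longrightarrow> L \<subseteq> U \<Longrightarrow> t < c U"
proof -
  obtain C :: "('a \<times> (nat \<Rightarrow> nat)) set" where C: "closed C" "A = fst ` C"
    using \<open>analytic A\<close> unfolding analytic_def by blast
  obtain K0 :: "nat \<Rightarrow> 'a set" where K0: "\<And>n. compact (K0 n)" "UNIV = (\<Union>n. K0 n)"
    using open_eq_UN_compact[OF lc open_UNIV] by blast
  \<comment> \<open>The point is confined to a finite union of the compact sets \<open>K0 i\<close>,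
    and only the first \<open>n\<close> terms of the sequence are bounded by
    \<open>b\<close>.\<close>
  define B where "B m b n = fst ` (C \<inter> (\<Union>i\<le>m. K0 i) \<times> {\<sigma>. \<forall>i<n. \<sigma> i \<le> b i})"
    for m n :: nat and b :: "nat \<Rightarrow> nat"
  have "A = (\<Union>m. B m b 0)" for b
  proof -
    have "\<exists>m. x \<in> (\<Union>i\<le>m. K0 i)" for x
      using K0(2) by (metis UNIV_I UN_iff atMost_iff order_refl)
    then have "C = (\<Union>m. C \<inter> (\<Union>i\<le>m. K0 i) \<times> UNIV)" by auto
    then have "fst ` C = (\<Union>m. fst ` (C \<inter> (\<Union>i\<le>m. K0 i) \<times> UNIV))"
      by (metis image_UN)
    then show ?thesis by (simp add: C(2) B_def)
  qed
  moreover have "incseq (\<lambda>m. B m b 0)" for b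
    unfolding incseq_def B_def
    by (intro allI impI image_mono Int_mono Sigma_mono UN_mono) auto
  ultimately have "\<exists>m. t < c (B m b 0)" for b
    using \<open>t < c A\<close> up[of "\<lambda>m. B m b 0"] by (simp add: less_SUP_iff)
  then obtain m where m: "t < c (B m (\<lambda>_. 0) 0)" by blast
  define K where "K = (\<Union>i\<le>m. K0 i)"
  have "compact K" unfolding K_def by (intro compact_UN K0) auto
  \<comment> \<open>Letting the bound \<open>k\<close> on term \<open>n\<close> grow exhausts
    \<open>B m b n\<close>, so continuity along increasing sequences yields a large enough
    \<open>k\<close>.\<close>
  have step: "\<exists>k. t < c (B m (b(n := k)) (Suc n))" if "t < c (B m b n)" for b n
  proof -
    have "B m b n = (\<Union>k. B m (b(n := k)) (Suc n))"
    proof -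
      have "{\<sigma>. \<forall>i<n. \<sigma> i \<le> b i} = (\<Union>k. {\<sigma>. \<forall>i<Suc n. \<sigma> i \<le> (b(n := k)) i})"
        by (auto simp: less_Suc_eq all_conj_distrib)
      then show ?thesis unfolding B_def by auto
    qed
    moreover have "incseq (\<lambda>k. B m (b(n := k)) (Suc n))"
      unfolding incseq_def B_def
      by (intro allI impI image_mono Int_mono Sigma_mono) (auto simp: less_Suc_eq intro: order_trans)
    ultimately show ?thesis
      using that up[of "\<lambda>k. B m (b(n := k)) (Suc n)"] by (simp add: less_SUP_iff)
  qed
  have "\<exists>g. \<forall>n. (t < c (B m (g n) n)) \<and> (\<exists>k. g (Suc n) = (g n)(n := k))"
    by (rule dependent_nat_choice) (use m step in blast)+
  then obtain g where g: "\<And>n. t < c (B m (g n) n)" "\<And>n. \<exists>k. g (Suc n) = (g n)(n := k)"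
    by blast
  \<comment> \<open>Stage \<open>Suc n\<close> alters only entry \<open>n\<close>, so entry
    \<open>i\<close> is final from stage \<open>Suc i\<close> on, and the diagonal \<open>b\<close>
    agrees with \<open>g n\<close> below \<open>n\<close>.\<close>
  define b where "b i = g (Suc i) i" for i
  have gb: "g n i = b i" if "i < n" for n i
    using that
  proof (induction n)
    case (Suc n)
    show ?case
    proof (cases "i = n")
      case False
      then have "g (Suc n) i = g n i" using g(2)[of n] by auto
      with False Suc show ?thesis by simp
    qed (simp add: b_def)
  qed simp
  have Bb: "t < c (B m b n)" for n
  proof -
    have "B m b n = B m (g n) n" unfolding B_def using gb by auto
    with g(1) show ?thesis by simp
  qed
  define L where "L = fst ` (C \<inter> K \<times> {\<sigma>. \<forall>i. \<sigma> i \<le> b i})"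
  have "compact L"
    unfolding L_def
    by (intro compact_continuous_image continuous_on_fst continuous_on_id closed_Int_compact[OF C(1)]
        compact_Times \<open>compact K\<close> compact_bounded_sequences)
  moreover have "L \<subseteq> A" by (auto simp: L_def C)
  moreover have "t < c U" if U: "open U" "L \<subseteq> U" for U
  proof -
    \<comment> \<open>By compactness: points of \<open>B m b n\<close> outside \<open>U\<close> for
      every \<open>n\<close> would yield a point of \<open>L\<close> outside
      \<open>U\<close>.\<close>
    have "\<exists>n. B m b n \<subseteq> U"
    proof (rule ccontr)
      assume "\<nexists>n. B m b n \<subseteq> U"
      have "\<exists>p. p \<in> C \<and> fst p \<in> K - U \<and> (\<forall>i<n. snd p i \<le> b i)" for n
      proof -
        obtain x where "x \<in> B m b n" "x \<notin> U" using \<open>\<nexists>n. B m b n \<subseteq> U\<close> by blast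
        then obtain p where "p \<in> C \<inter> K \<times> {\<sigma>. \<forall>i<n. \<sigma> i \<le> b i}" "x = fst p"
          unfolding B_def K_def by blast
        with \<open>x \<notin> U\<close> show ?thesis by (intro exI[of _ p]) (auto simp: mem_Times_iff)
      qed
      then obtain p where p: "\<And>n. p n \<in> C" "\<And>n. fst (p n) \<in> K - U"
          "\<And>n i. i < n \<Longrightarrow> snd (p n) i \<le> b i"
        by metis
      \<comment> \<open>Only the finitely many \<open>p n\<close> with \<open>n \<le> i\<close> may
        exceed \<open>b i\<close> in term \<open>i\<close>, so \<open>d\<close> bounds all the
        sequences at once and every \<open>p n\<close> lies in one compact set.\<close>
      define d where "d i = Max (insert (b i) ((\<lambda>n. snd (p n) i) ` {..i}))" for i
      have d: "snd (p n) i \<le> d i" for n i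
      proof (cases "i < n")
        case True
        then have "snd (p n) i \<le> b i" by (rule p)
        also have "b i \<le> d i" by (simp add: d_def)
        finally show ?thesis .
      next
        case False
        then have "snd (p n) i \<in> insert (b i) ((\<lambda>n. snd (p n) i) ` {..i})" by auto
        then show ?thesis unfolding d_def by (intro Max_ge) auto
      qed
      define S where "S = C \<inter> (K - U) \<times> {\<sigma>. \<forall>i. \<sigma> i \<le> d i}"
      have "compact S"
        unfolding S_def
        by (intro closed_Int_compact[OF C(1)] compact_Times compact_bounded_sequences
            compact_diff[OF \<open>compact K\<close> U(1)])
      define T where "T i = {q :: 'a \<times> (nat \<Rightarrow> nat). snd q i \<le> b i}" for i
      have closed_T: "closed (T i)" for i
      proof -
        have "closed ((\<lambda>q :: 'a \<times> (nat \<Rightarrow> nat). snd q i) -` {..b i})"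
          by (intro closed_vimage closed_atMost continuous_on_snd_apply)
        then show ?thesis by (simp add: T_def vimage_def)
      qed
      \<comment> \<open>Finitely many constraints \<open>T i\<close> all hold at \<open>p n\<close>
        once \<open>n\<close> exceeds their indices.\<close>
      have fip: "S \<inter> \<Inter>(T ` I) \<noteq> {}" if fin: "finite I" for I
      proof -
        obtain n where "\<And>i. i \<in> I \<Longrightarrow> i < n"
          using finite_nat_bounded[OF fin] by (auto simp: subset_eq)
        then have "\<forall>i\<in>I. p n \<in> T i"
          using p(3) by (simp add: T_def)
        moreover have "p n \<in> S"
          using p(1)[of n] p(2)[of n] d[of n] by (simp add: S_def mem_Times_iff)
        ultimately show ?thesis by blast
      qed
      have "S \<inter> \<Inter>(T ` UNIV) \<noteq> {}"
        by (rule compact_imp_fip_image[OF \<open>compact S\<close> closed_T fip])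
      then obtain q where "q \<in> S" "q \<in> \<Inter>(T ` UNIV)" by blast
      then have q: "q \<in> S" "\<And>i. snd q i \<le> b i" by (simp_all add: T_def)
      then have "q \<in> C \<inter> K \<times> {\<sigma>. \<forall>i. \<sigma> i \<le> b i}"
        by (simp add: S_def mem_Times_iff)
      then have "fst q \<in> L" unfolding L_def by (rule imageI)
      moreover have "fst q \<notin> U" using q(1) by (simp add: S_def mem_Times_iff)
      ultimately show False using U(2) by blast
    qed
    then show ?thesis using Bb mono by (meson less_le_trans)
  qed
  ultimately show ?thesis by (rule that)
qed

section \<open>Semicontinuous functions and the fine topology\<close>

lemma lsc_regularization_le: "lsc_regularization f x \<le> f x"
  unfolding lsc_regularization_def
proof (rule Liminf_least)
  fix P assume "eventually P (nhds x)"
  then have "P x" by (rule eventually_nhds_x_imp_x)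
  then show "(INF y\<in>Collect P. f y) \<le> f x" by (intro INF_lower) simp
qed

lemma lsc_regularization_mono: "f \<le> g \<Longrightarrow> lsc_regularization f \<le> lsc_regularization g"
  by (auto simp: lsc_regularization_def le_fun_def intro!: Liminf_mono)

lemma lsc_minorant_le_lsc_regularization:
  assumes "lower_semicontinuous g" "g \<le> f"
  shows "g \<le> lsc_regularization f"
proof (rule le_funI)
  fix x
  show "g x \<le> lsc_regularization f x"
    unfolding lsc_regularization_def le_Liminf_iff
  proof safe
    fix c assume "c < g x"
    then have "eventually (\<lambda>y. y \<in> {y. c < g y}) (nhds x)"
      using assms(1) by (intro eventually_nhds_in_open) (auto simp: lower_semicontinuous_def)
    then show "eventually (\<lambda>y. c < f y) (nhds x)"
      by eventually_elim (use assms(2) in \<open>auto simp: le_fun_def intro: less_le_trans\<close>)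
  qed
qed

lemma topspace_fine_topology [simp]: "topspace (fine_topology W) = UNIV"
  unfolding fine_topology_def topology_generated_by_topspace by blast

lemma open_imp_openin_fine: "open U \<Longrightarrow> openin (fine_topology W) U"
  unfolding fine_topology_def by (intro topology_generated_by_Basis) auto

lemma openin_fine_vimage: "u \<in> W \<Longrightarrow> open V \<Longrightarrow> openin (fine_topology W) (u -` V)"
  unfolding fine_topology_def by (intro topology_generated_by_Basis) auto

lemma eventually_fine:
  "eventually P (nhdsin (fine_topology W) x) \<longleftrightarrow>
    (\<exists>U. openin (fine_topology W) U \<and> x \<in> U \<and> (\<forall>y\<in>U. P y))"
  by (simp add: eventually_nhdsin)

lemma fine_lsc_regularization_le: "fine_lsc_regularization W f x \<le> f x"
  unfolding fine_lsc_regularization_def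
proof (rule Liminf_least)
  fix P assume "eventually P (nhdsin (fine_topology W) x)"
  then have "P x" by (auto simp: eventually_fine)
  then show "(INF y\<in>Collect P. f y) \<le> f x" by (intro INF_lower) simp
qed

text \<open>A rational strictly between the two values replaces the difference \<open>g - f\<close>,
  which is problematic at infinite values.\<close>

lemma openin_fine_less:
  assumes "f \<in> W" "g \<in> W"
  shows "openin (fine_topology W) {x. f x < g x}"
proof -
  have "{x. f x < g x} = (\<Union>r::rat. f -` {..<ereal (of_rat r)} \<inter> g -` {ereal (of_rat r)<..})"
  proof (intro equalityI subsetI)
    fix x assume "x \<in> {x. f x < g x}"
    then obtain r :: rat where "f x < real_of_rat r" "real_of_rat r < g x"
      using ereal_dense3 by blast
    then show "x \<in> (\<Union>r::rat. f -` {..<ereal (of_rat r)} \<inter> g -` {ereal (of_rat r)<..})" by auto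
  qed auto
  then show ?thesis
    by (auto intro!: openin_Union openin_Int openin_fine_vimage assms)
qed

section \<open>Reduites and their regularizations\<close>

lemma reduite_mono: "\<phi> \<le> \<psi> \<Longrightarrow> reduite W \<phi> \<le> reduite W \<psi>"
  unfolding reduite_def by (intro Inf_superset_mono) (auto intro: order_trans)

lemma regularized_reduite_mono:
  "\<phi> \<le> \<psi> \<Longrightarrow> regularized_reduite W \<phi> \<le> regularized_reduite W \<psi>"
  unfolding regularized_reduite_def by (intro lsc_regularization_mono reduite_mono)

lemma le_reduite: "\<phi> \<le> reduite W \<phi>"
  unfolding reduite_def by (rule Inf_greatest) simp

lemma reduite_le: "u \<in> W \<Longrightarrow> \<phi> \<le> u \<Longrightarrow> reduite W \<phi> \<le> u"
  unfolding reduite_def by (rule Inf_lower) simp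

lemma regularized_reduite_le_reduite: "regularized_reduite W \<phi> \<le> reduite W \<phi>"
  unfolding regularized_reduite_def by (auto simp: le_fun_def intro: lsc_regularization_le)

section \<open>The class of upper semicontinuous minorants\<close>

lemma usc_minorantsI:
  fixes \<psi> :: "'a::t2_space \<Rightarrow> ereal"
  assumes "upper_semicontinuous \<psi>" "\<And>x. \<psi> x \<le> ereal M" "\<And>x. 0 \<le> \<psi> x" "\<psi> \<le> \<phi>"
    and "compact K" "\<And>x. x \<notin> K \<Longrightarrow> \<psi> x = 0" "\<And>x. x \<in> K \<Longrightarrow> 0 < \<phi> x"
  shows "\<psi> \<in> usc_minorants \<phi>"
proof -
  have sub: "closure {x. \<psi> x \<noteq> 0} \<subseteq> K"
    using assms(6) by (intro closure_minimal compact_imp_closed[OF assms(5)]) blast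
  then have "compact (closure {x. \<psi> x \<noteq> 0})"
    using closed_Int_compact[OF closed_closure assms(5)] by (metis inf.absorb_iff1)
  moreover have "closure {x. \<psi> x \<noteq> 0} \<subseteq> {x. 0 < \<phi> x}"
    using sub assms(7) by blast
  ultimately show ?thesis
    unfolding usc_minorants_def using assms(1-4) by simp blast
qed

lemma mult_indicator_usc_minorant:
  assumes "compact (K :: 'a::t2_space set)" "0 < q" "\<And>x. x \<in> K \<Longrightarrow> ereal q \<le> \<phi> x" "\<And>x. 0 \<le> \<phi> x"
  shows "(\<lambda>x. ereal q * indicator K x) \<in> usc_minorants \<phi>"
proof -
  have "closed K" using assms(1) by (rule compact_imp_closed)
  have "open {x. ereal q * indicator K x < c}" for c
  proof -
    have "{x. ereal q * indicator K x < c} = (if ereal q < c then UNIV else if 0 < c then - K else {})"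
    proof (cases "ereal q < c")
      case True
      moreover have "0 < ereal q" using \<open>0 < q\<close> by simp
      ultimately have "0 < c" by (rule less_trans[rotated])
      with True show ?thesis by (auto simp: indicator_def)
    next
      case False
      then show ?thesis by (auto simp: indicator_def)
    qed
    then show ?thesis using \<open>closed K\<close> by (simp add: open_Compl)
  qed
  then show ?thesis
  proof (intro usc_minorantsI)
    show "ereal q * indicator K x \<le> ereal q" for x
      using \<open>0 < q\<close> by (simp add: indicator_def)
    show "compact K" by fact
    fix x assume "x \<in> K"
    have "0 < ereal q" using \<open>0 < q\<close> by simp
    also have "ereal q \<le> \<phi> x" using \<open>x \<in> K\<close> by (rule assms(3))
    finally show "0 < \<phi> x" .
  qed (use assms in \<open>simp_all add: upper_semicontinuous_def indicator_def le_fun_def\<close>)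
qed

text \<open>Makes the class upward directed, so that a countable family can later be replaced by its
  running maxima.\<close>

lemma sup_usc_minorants:
  fixes f g :: "'a::t2_space \<Rightarrow> ereal"
  assumes "f \<in> usc_minorants \<phi>" "g \<in> usc_minorants \<phi>"
  shows "sup f g \<in> usc_minorants \<phi>"
proof -
  have eq: "{x. sup f g x < c} = {x. f x < c} \<inter> {x. g x < c}" for c
    by (auto simp: sup_fun_def)
  obtain M M' :: real where M: "\<And>x. f x \<le> ereal M" "\<And>x. g x \<le> ereal M'"
  proof -
    have "\<exists>M::real. \<forall>x. f x \<le> ereal M" "\<exists>M::real. \<forall>x. g x \<le> ereal M"
      using assms by (simp_all add: usc_minorants_def)
    then show ?thesis using that by blast
  qed
  have bd: "sup f g x \<le> ereal (max M M')" for x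
    unfolding sup_fun_def
    by (intro sup_least order_trans[OF M(1)] order_trans[OF M(2)]) simp_all
  have K: "compact (closure {x. f x \<noteq> 0} \<union> closure {x. g x \<noteq> 0})"
    using assms by (simp add: usc_minorants_def compact_Un)
  show ?thesis
  proof (rule usc_minorantsI)
    show "sup f g x \<le> ereal (max M M')" for x by (rule bd)
    show "compact (closure {x. f x \<noteq> 0} \<union> closure {x. g x \<noteq> 0})" by (rule K)
    show "upper_semicontinuous (sup f g)"
      using assms unfolding upper_semicontinuous_def eq
      by (simp add: usc_minorants_def upper_semicontinuous_def open_Int)
    fix x assume "x \<notin> closure {x. f x \<noteq> 0} \<union> closure {x. g x \<noteq> 0}"
    then have "x \<notin> {x. f x \<noteq> 0}" "x \<notin> {x. g x \<noteq> 0}"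
      using closure_subset[of "{x. f x \<noteq> 0}"] closure_subset[of "{x. g x \<noteq> 0}"] by auto
    then show "sup f g x = 0" by (simp add: sup_fun_def)
  next
    fix x assume "x \<in> closure {x. f x \<noteq> 0} \<union> closure {x. g x \<noteq> 0}"
    moreover have "closure {x. f x \<noteq> 0} \<union> closure {x. g x \<noteq> 0} \<subseteq> {x. 0 < \<phi> x}"
      using assms by (simp add: usc_minorants_def)
    ultimately have "x \<in> {x. 0 < \<phi> x}" by (rule subsetD[rotated])
    then show "0 < \<phi> x" by simp
  next
    have "f \<le> \<phi>" "g \<le> \<phi>" using assms by (simp_all add: usc_minorants_def)
    then show "sup f g \<le> \<phi>" by simp
    have "0 \<le> f x" for x using assms by (simp add: usc_minorants_def)
    then show "0 \<le> sup f g x" for x by (simp add: sup_fun_def le_max_iff_disj)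
  qed
qed

lemma zero_usc_minorants: "(\<And>x. 0 \<le> \<phi> x) \<Longrightarrow> (\<lambda>x. 0) \<in> usc_minorants \<phi>"
  unfolding usc_minorants_def upper_semicontinuous_def
  by (auto simp: le_fun_def intro!: exI[of _ 0])

text \<open>Lindelof gives a countable subfamily for each superlevel set at a rational level, and
  the rational levels determine the supremum.\<close>

lemma lsc_SUP_countable:
  fixes F :: "'i \<Rightarrow> 'a::second_countable_topology \<Rightarrow> ereal"
  assumes "\<And>i. i \<in> I \<Longrightarrow> lower_semicontinuous (F i)"
  obtains J where "J \<subseteq> I" "countable J" "(SUP i\<in>J. F i) = (SUP i\<in>I. F i)"
proof -
  have "\<exists>J\<subseteq>I. countable J \<and> (\<Union>i\<in>J. {x. ereal (of_rat r) < F i x}) = (\<Union>i\<in>I. {x. ereal (of_rat r) < F i x})"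
    for r :: rat
    using assms Lindelof_image[of I "\<lambda>i. {x. ereal (of_rat r) < F i x}"]
    unfolding lower_semicontinuous_def by metis
  then obtain J where J: "\<And>r. J r \<subseteq> I" "\<And>r. countable (J r)"
    "\<And>r::rat. (\<Union>i\<in>J r. {x. ereal (of_rat r) < F i x}) = (\<Union>i\<in>I. {x. ereal (of_rat r) < F i x})"
    by metis
  have le: "(SUP i\<in>I. F i) x \<le> (SUP i\<in>(\<Union>r. J r). F i) x" for x
  proof (rule ccontr)
    assume "\<not> ?thesis"
    then obtain r :: rat where r: "(SUP i\<in>(\<Union>r. J r). F i) x < real_of_rat r"
      "real_of_rat r < (SUP i\<in>I. F i) x"
      using ereal_dense3 by (metis not_le)
    then obtain i where "i \<in> I" "real_of_rat r < F i x"
      by (auto simp: less_SUP_iff)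
    then obtain j where "j \<in> J r" "real_of_rat r < F j x"
      using J(3)[of r] by blast
    then have "real_of_rat r < (SUP i\<in>(\<Union>r. J r). F i) x"
      unfolding SUP_apply less_SUP_iff by blast
    with r(1) show False by simp
  qed
  have sub: "(\<Union>r. J r) \<subseteq> I" using J(1) by blast
  have "(SUP i\<in>(\<Union>r. J r). F i) = (SUP i\<in>I. F i)"
    by (rule antisym[OF SUP_subset_mono[OF sub order_refl] le_funI[OF le]])
  moreover have "countable (\<Union>r. J r)"
    by (intro countable_UN J(2)) simp
  ultimately show ?thesis by (intro that[OF sub])
qed

section \<open>Polar sets in balayage spaces\<close>

lemma scale_small:
  fixes a :: ereal
  assumes "0 \<le> a" "a < \<infinity>" "(0::real) < e"
  obtains c :: real where "0 < c" "ereal c * a \<le> ereal e"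
proof -
  obtain r where r: "a = ereal r" "0 \<le> r"
    using assms(1,2) by (cases a) auto
  \<comment> \<open>The denominator \<open>r + 1\<close> also covers \<open>a = 0\<close>.\<close>
  have "e / (r + 1) * r \<le> e"
    using r assms(3) by (simp add: field_simps)
  then show ?thesis
    using that[of "e / (r + 1)"] r assms(3) by simp
qed

context balayage_space
begin

lemma zero_in: "(\<lambda>x. 0) \<in> W"
proof -
  obtain u where "u \<in> W" using B4_infinity by blast
  from cone_scale[OF this, of 0] show ?thesis by (simp add: zero_ereal_def[symmetric])
qed

text \<open>Multiples of \<open>w\<close> serve later as finite perturbations, to attain a
  prescribed value at one point or to make an inequality strict.\<close>

lemma pos_continuous: obtains w where "w \<in> W" "\<And>x. 0 < w x" "\<And>x. w x < \<infinity>"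
proof -
  obtain w where "w \<in> W" "continuous_real w" "\<forall>x. 0 < w x"
    using B4_infinity by blast
  moreover have "w x < \<infinity>" for x
    using \<open>continuous_real w\<close> unfolding continuous_real_def by (cases "w x") (auto dest: spec[of _ x])
  ultimately show ?thesis using that by blast
qed

text \<open>By B2 the fine regularization lies in \<open>W\<close>, hence is lower semicontinuous in
  the initial topology and a minorant of the initial regularization. The reverse inequality holds
  because the fine topology has more neighbourhoods.\<close>

lemma fine_lsc_regularization_eq:
  assumes "V \<subseteq> W"
  shows "fine_lsc_regularization W (Inf V) = lsc_regularization (Inf V)"
proof (rule antisym)
  show "fine_lsc_regularization W (Inf V) \<le> lsc_regularization (Inf V)"
    by (intro lsc_minorant_le_lsc_regularization lsc B2 assms le_funI fine_lsc_regularization_le)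
  show "lsc_regularization (Inf V) \<le> fine_lsc_regularization W (Inf V)"
  proof (rule le_funI)
    fix x
    show "lsc_regularization (Inf V) x \<le> fine_lsc_regularization W (Inf V) x"
      unfolding fine_lsc_regularization_def le_Liminf_iff
    proof safe
      fix c assume "c < lsc_regularization (Inf V) x"
      then have "eventually (\<lambda>y. c < Inf V y) (nhds x)"
        unfolding lsc_regularization_def by (rule less_LiminfD)
      then show "eventually (\<lambda>y. c < Inf V y) (nhdsin (fine_topology W) x)"
        unfolding eventually_nhds eventually_fine using open_imp_openin_fine by blast
    qed
  qed
qed

lemma lsc_regularization_in: "V \<subseteq> W \<Longrightarrow> lsc_regularization (Inf V) \<in> W"
  using B2 fine_lsc_regularization_eq by metis

lemma regularized_reduite_in: "regularized_reduite W \<phi> \<in> W"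
  unfolding regularized_reduite_def reduite_def by (rule lsc_regularization_in) blast

text \<open>If \<open>{x}\<close> were finely open, the infimum of all \<open>u \<in> W\<close> with \<open>u x = \<infinity>\<close> would be \<open>\<infinity>\<close> at \<open>x\<close>, \<open>0\<close>
  elsewhere, and equal to its own regularization, so that \<open>x\<close> would be an interior point of \<open>P\<close>.\<close>

lemma fine_isolated_in_polar:
  assumes P: "polar W P" "x \<in> P" shows "\<not> openin (fine_topology W) {x}"
proof
  assume iso: "openin (fine_topology W) {x}"
  define h where "h = Inf {u \<in> W. u x = \<infinity>}"
  have hx: "\<infinity> \<le> h x" unfolding h_def Inf_apply by (rule INF_greatest) simp
  have hy: "h y \<le> 0" if "y \<noteq> x" for y
  proof (rule ereal_le_epsilon2)
    fix e :: real assume "0 < e"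
    \<comment> \<open>Polarity is used at \<open>y\<close>, not at \<open>x\<close>: this
      \<open>u\<close> is infinite at \<open>x\<close> and becomes small at \<open>y\<close> after
      scaling.\<close>
    obtain u where u: "u \<in> W" "\<forall>z\<in>P - {y}. u z = \<infinity>" "u y < \<infinity>"
      using P(1) unfolding polar_def by blast
    obtain c where c: "0 < c" "ereal c * u y \<le> ereal e"
      using scale_small[OF nonneg[OF u(1)] u(3) \<open>0 < e\<close>] by blast
    have "u x = \<infinity>" using u(2) P(2) that by blast
    then have "(\<lambda>z. ereal c * u z) \<in> {u \<in> W. u x = \<infinity>}"
      using cone_scale[OF u(1), of c] c by simp
    then have "h \<le> (\<lambda>z. ereal c * u z)" unfolding h_def by (rule Inf_lower)
    then have "h y \<le> ereal c * u y" by (rule le_funD)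
    with c show "h y \<le> 0 + ereal e" by simp
  qed
  define g where "g = fine_lsc_regularization W h"
  have "g \<in> W" unfolding g_def h_def by (rule B2) blast
  have "\<infinity> \<le> g x"
    unfolding g_def fine_lsc_regularization_def
    by (rule Liminf_bounded) (use iso hx in \<open>auto simp: eventually_fine intro!: exI[of _ "{x}"]\<close>)
  moreover have "g y \<le> 0" if "y \<noteq> x" for y
    using fine_lsc_regularization_le[of W h y] hy[OF that] unfolding g_def by (rule order_trans)
  ultimately have "{y. 0 < g y} = {x}" by (auto simp: not_less[symmetric])
  moreover have "open {y. 0 < g y}"
    using lsc[OF \<open>g \<in> W\<close>] unfolding lower_semicontinuous_def by blast
  ultimately have "x \<in> interior P"
    using P(2) by (auto simp: interior_def)
  then show False using P(1) by (simp add: polar_def)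
qed

text \<open>Since \<open>u\<close> is finely continuous, \<open>{u < \<infinity>}\<close> is finely
  open, and it meets \<open>U\<close> only in \<open>x\<close>.\<close>

lemma fine_isolatedI:
  assumes "openin (fine_topology W) U" "x \<in> U" "u \<in> W" "\<And>y. y \<in> U - {x} \<Longrightarrow> u y = \<infinity>" "u x < \<infinity>"
  shows "openin (fine_topology W) {x}"
proof -
  have "U \<inter> u -` {..<\<infinity>} = {x}" using assms(2,4,5) by fastforce
  moreover have "openin (fine_topology W) (U \<inter> u -` {..<\<infinity>})"
    using assms(1,3) by (intro openin_Int openin_fine_vimage) auto
  ultimately show ?thesis by simp
qed

lemma polar_fine_interior:
  assumes "polar W P" "openin (fine_topology W) U" "U \<subseteq> P" shows "U = {}"
proof (rule ccontr)
  assume "U \<noteq> {}"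
  then obtain x where "x \<in> U" by blast
  obtain u where "u \<in> W" "\<forall>y\<in>P - {x}. u y = \<infinity>" "u x < \<infinity>"
    using assms(1) unfolding polar_def by blast
  with assms(2,3) \<open>x \<in> U\<close> have "openin (fine_topology W) {x}"
    by (intro fine_isolatedI[of U x u]) auto
  then show False using fine_isolated_in_polar[OF assms(1)] \<open>x \<in> U\<close> assms(3) by blast
qed

lemma polar_subset: "polar W P \<Longrightarrow> Q \<subseteq> P \<Longrightarrow> polar W Q"
  unfolding polar_def by (metis Diff_mono interior_mono order_refl subset_empty subsetD)

lemma polar_UN_nat:
  fixes P :: "nat \<Rightarrow> 'a set"
  assumes P: "\<And>n. polar W (P n)" shows "polar W (\<Union>n. P n)"
proof -
  have ex: "\<exists>v\<in>W. (\<forall>y\<in>(\<Union>n. P n) - {x}. v y = \<infinity>) \<and> v x < \<infinity>" for x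
  proof -
    have "\<exists>u\<in>W. (\<forall>y\<in>P n - {x}. u y = \<infinity>) \<and> u x < \<infinity>" for n
      using P[of n] unfolding polar_def by blast
    then obtain u where u: "\<And>n. u n \<in> W" "\<And>n y. y \<in> P n - {x} \<Longrightarrow> u n y = \<infinity>" "\<And>n. u n x < \<infinity>"
      by metis
    \<comment> \<open>The bounds \<open>(1/2)^n\<close> keep the series finite at \<open>x\<close>,
      while positive factors preserve the value \<open>\<infinity>\<close> on
      \<open>P n - {x}\<close>.\<close>
    have "\<exists>c>0. ereal c * u n x \<le> ereal ((1/2)^n)" for n
      using scale_small[OF nonneg[OF u(1)] u(3), of "(1/2)^n"] by (metis half_gt_zero zero_less_one zero_less_power)
    then obtain c where c: "\<And>n. 0 < c n" "\<And>n. ereal (c n) * u n x \<le> ereal ((1/2)^n)"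
      by metis
    define s where "s n = (\<lambda>y. \<Sum>k<n. ereal (c k) * u k y)" for n
    have term_nonneg: "0 \<le> ereal (c k) * u k y" for k y
      using c(1)[of k] nonneg[OF u(1)] by (simp add: less_imp_le)
    have s_in: "s n \<in> W" for n
    proof (induction n)
      case 0
      show ?case using zero_in by (simp add: s_def)
    next
      case (Suc n)
      have "s (Suc n) = (\<lambda>y. s n y + ereal (c n) * u n y)" by (simp add: s_def)
      with cone_add[OF Suc cone_scale[OF u(1)[of n], of "c n"]] c(1)[of n] show ?case by simp
    qed
    have "incseq s"
      by (intro incseq_SucI le_funI) (simp add: s_def add_increasing2 term_nonneg)
    then have v_in: "(SUP n. s n) \<in> W" using B1[of s] s_in by blast
    have "(SUP n. s n) y = \<infinity>" if "y \<in> P n - {x}" for n y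
    proof -
      have "\<infinity> = ereal (c n) * u n y" using u(2)[OF that] c(1)[of n] by simp
      also have "\<dots> \<le> s (Suc n) y"
        by (simp add: s_def sum_nonneg term_nonneg add_increasing)
      also have "\<dots> \<le> (SUP n. s n) y" by (intro le_funD[OF SUP_upper]) simp
      finally show ?thesis by simp
    qed
    moreover have "s n x \<le> ereal 2" for n
    proof -
      have "s n x \<le> (\<Sum>k<n. ereal ((1/2)^k))" unfolding s_def by (intro sum_mono c)
      also have "\<dots> = ereal (\<Sum>k<n. (1/2)^k)" by (simp add: sum_ereal)
      also have "(\<Sum>k<n. (1/2::real)^k) \<le> 2" by (simp add: geometric_sum)
      finally show ?thesis by simp
    qed
    then have "(SUP n. s n) x \<le> ereal 2" by (simp add: SUP_le_iff)
    then have "(SUP n. s n) x < \<infinity>" by (rule le_less_trans) simp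
    ultimately show ?thesis using v_in by blast
  qed
  \<comment> \<open>Empty interiors alone need not survive a countable union. Here an interior point
    \<open>x\<close> would be finely isolated by the series, although it lies in some polar
    \<open>P n\<close>.\<close>
  have "interior (\<Union>n. P n) = {}"
  proof (rule ccontr)
    assume "interior (\<Union>n. P n) \<noteq> {}"
    then obtain x where x: "x \<in> interior (\<Union>n. P n)" by blast
    then obtain n where "x \<in> P n" using interior_subset by blast
    obtain v where "v \<in> W" "\<forall>y\<in>(\<Union>n. P n) - {x}. v y = \<infinity>" "v x < \<infinity>" using ex by blast
    moreover have "interior (\<Union>n. P n) - {x} \<subseteq> (\<Union>n. P n) - {x}"
      using interior_subset by blast
    ultimately have "openin (fine_topology W) {x}"
      using x by (intro fine_isolatedI[of "interior (\<Union>n. P n)" x v] open_imp_openin_fine) auto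
    with fine_isolated_in_polar[OF P \<open>x \<in> P n\<close>] show False by blast
  qed
  with ex show ?thesis unfolding polar_def by blast
qed

lemma polar_UN:
  fixes P :: "'i::countable \<Rightarrow> 'a set"
  assumes "\<And>i. polar W (P i)" shows "polar W (\<Union>i. P i)"
proof -
  have "(\<Union>i. P i) = (\<Union>n. P (from_nat n))"
    using surj_from_nat by (metis UN_simps(10))
  with assms show ?thesis using polar_UN_nat[of "\<lambda>n. P (from_nat n)"] by simp
qed

lemma polar_Un: "polar W P \<Longrightarrow> polar W Q \<Longrightarrow> polar W (P \<union> Q)"
  using polar_UN[of "\<lambda>b. if b then P else Q"] by (auto simp: UNIV_bool Un_commute)

lemma polar_empty: "polar W {}"
  unfolding polar_def using zero_in by (auto intro!: bexI[of _ "\<lambda>x. 0"])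

section \<open>Comparison off polar sets\<close>

lemma le_if_le_off_polar:
  assumes "f \<in> W" "g \<in> W" "polar W P" "\<And>x. x \<notin> P \<Longrightarrow> f x \<le> g x"
  shows "f \<le> g"
proof -
  have "{x. g x < f x} = {}"
    using assms(4) by (intro polar_fine_interior[OF assms(3) openin_fine_less[OF assms(2,1)]])
      (auto simp: not_le[symmetric])
  then show ?thesis by (auto simp: le_fun_def not_less[symmetric])
qed

text \<open>A small multiple of a function infinite on \<open>P - {x}\<close> and finite at
  \<open>x\<close> absorbs the exceptional set; only \<open>x\<close> itself escapes it, whence the
  separate assumption at \<open>x\<close>.\<close>

lemma reduite_le_if_le_off_polar:
  assumes "v \<in> W" "polar W P" "\<And>y. y \<notin> P \<Longrightarrow> \<phi> y \<le> v y" "\<phi> x \<le> v x"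
  shows "reduite W \<phi> x \<le> v x"
proof (rule ereal_le_epsilon2)
  fix e :: real assume "0 < e"
  obtain u where u: "u \<in> W" "\<forall>z\<in>P - {x}. u z = \<infinity>" "u x < \<infinity>"
    using assms(2) unfolding polar_def by blast
  obtain c where c: "0 < c" "ereal c * u x \<le> ereal e"
    using scale_small[OF nonneg[OF u(1)] u(3) \<open>0 < e\<close>] by blast
  have cu: "0 \<le> ereal c * u y" for y using c nonneg[OF u(1)] by simp
  have "\<phi> y \<le> v y + ereal c * u y" for y
  proof (cases "y \<in> P - {x}")
    case True
    then show ?thesis using u(2) c nonneg[OF assms(1), of y] by simp
  next
    case False
    then have "\<phi> y \<le> v y" using assms(3,4) by blast
    also have "v y \<le> v y + ereal c * u y" using cu[of y] by (simp add: add_increasing2)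
    finally show ?thesis .
  qed
  then have "\<phi> \<le> (\<lambda>y. v y + ereal c * u y)" by (rule le_funI)
  moreover have "(\<lambda>y. v y + ereal c * u y) \<in> W"
    using c by (intro cone_add cone_scale assms u) simp
  ultimately have "reduite W \<phi> x \<le> v x + ereal c * u x"
    by (intro le_funD[OF reduite_le])
  also have "\<dots> \<le> v x + ereal e" using c by (intro add_left_mono)
  finally show "reduite W \<phi> x \<le> v x + ereal e" .
qed

text \<open>The pointwise estimate works off \<open>P\<close>; both sides being in \<open>W\<close>,
  fine continuity extends it to all points.\<close>

lemma regularized_reduite_le:
  assumes "v \<in> W" "polar W P" "\<And>y. y \<notin> P \<Longrightarrow> \<phi> y \<le> v y"
  shows "regularized_reduite W \<phi> \<le> v"
proof (rule le_if_le_off_polar[OF regularized_reduite_in assms(1,2)])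
  fix x assume "x \<notin> P"
  have "regularized_reduite W \<phi> x \<le> reduite W \<phi> x"
    using regularized_reduite_le_reduite by (rule le_funD)
  also have "\<dots> \<le> v x"
    by (rule reduite_le_if_le_off_polar[OF assms]) (use assms(3) \<open>x \<notin> P\<close> in auto)
  finally show "regularized_reduite W \<phi> x \<le> v x" .
qed

end


section \<open>Consequences of the axiom of polarity\<close>

locale polarity_balayage_space = balayage_space +
  assumes axiom_of_polarity: "axiom_of_polarity W"
begin

text \<open>The axiom of polarity enters the argument through this statement alone.\<close>

lemma polar_regularized_reduite_less: "polar W {x. regularized_reduite W \<phi> x < reduite W \<phi> x}"
proof -
  have "semipolar W {x. regularized_reduite W \<phi> x < reduite W \<phi> x}"
    unfolding semipolar_def regularized_reduite_def reduite_def
    by (intro exI[of _ "{u \<in> W. \<phi> \<le> u}"]) simp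
  then show ?thesis using axiom_of_polarity unfolding axiom_of_polarity_def by blast
qed

lemma le_regularized_reduite:
  "x \<notin> {x. regularized_reduite W \<phi> x < reduite W \<phi> x} \<Longrightarrow> \<phi> x \<le> regularized_reduite W \<phi> x"
  using le_funD[OF le_reduite[of \<phi> W], of x] by simp

lemma reduite_eq:
  assumes "\<And>x. 0 \<le> \<phi> x"
  shows "reduite W \<phi> = sup \<phi> (regularized_reduite W \<phi>)"
proof (rule antisym)
  show "sup \<phi> (regularized_reduite W \<phi>) \<le> reduite W \<phi>"
    by (intro sup_least le_reduite regularized_reduite_le_reduite)
  show "reduite W \<phi> \<le> sup \<phi> (regularized_reduite W \<phi>)"
  proof (rule le_funI)
    fix x
    let ?r = "regularized_reduite W \<phi>"
    show "reduite W \<phi> x \<le> sup \<phi> ?r x"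
    proof (cases "\<phi> x \<le> ?r x \<or> \<phi> x = \<infinity>")
      case True
      have "reduite W \<phi> x \<le> ?r x" if "\<phi> x \<le> ?r x"
        by (rule reduite_le_if_le_off_polar[OF regularized_reduite_in polar_regularized_reduite_less
              le_regularized_reduite that])
      with True show ?thesis by (auto simp: le_max_iff_disj sup_max)
    next
      case False
      \<comment> \<open>If \<open>\<phi> x\<close> is finite and exceeds the regularization at
        \<open>x\<close>, a multiple of \<open>w\<close> is added to the latter, with the factor
        chosen to give exactly \<open>\<phi> x\<close> at \<open>x\<close>.\<close>
      obtain w where w: "w \<in> W" "\<And>x. 0 < w x" "\<And>x. w x < \<infinity>"
        by (rule pos_continuous) blast
      obtain d where d: "w x = ereal d" "0 < d"
        using w(2)[of x] w(3)[of x] by (cases "w x") auto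
      obtain b where b: "\<phi> x = ereal b"
        using False assms[of x] by (cases "\<phi> x") auto
      obtain a where a: "?r x = ereal a" "a < b"
        using False b nonneg[OF regularized_reduite_in, of \<phi> x] by (cases "?r x") auto
      define v where "v = (\<lambda>y. ?r y + ereal ((b - a) / d) * w y)"
      have "v \<in> W"
        unfolding v_def using a d by (intro cone_add cone_scale regularized_reduite_in w) simp
      have rv: "?r y \<le> v y" for y
        unfolding v_def using a d w(2)[of y] by (simp add: add_increasing2 less_imp_le)
      have vx: "v x = \<phi> x"
        using d by (simp add: v_def a b)
      have "reduite W \<phi> x \<le> v x"
        by (rule reduite_le_if_le_off_polar[OF \<open>v \<in> W\<close> polar_regularized_reduite_less
              order_trans[OF le_regularized_reduite rv]]) (simp_all add: vx)
      then show ?thesis using vx by (simp add: le_max_iff_disj sup_max)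
    qed
  qed
qed

text \<open>By B1 the supremum of the regularized reduites lies in \<open>W\<close>, and it
  dominates \<open>SUP n. \<phi> n\<close> off a countable union of polar sets. This bounds the
  regularized reduite; \<open>reduite_eq\<close> restores the exact values.\<close>

lemma reduite_SUP:
  fixes \<phi> :: "nat \<Rightarrow> 'a \<Rightarrow> ereal"
  assumes "incseq \<phi>" "\<And>n x. 0 \<le> \<phi> n x"
  shows "reduite W (SUP n. \<phi> n) = (SUP n. reduite W (\<phi> n))"
proof (rule antisym)
  show "(SUP n. reduite W (\<phi> n)) \<le> reduite W (SUP n. \<phi> n)"
    by (intro SUP_least reduite_mono SUP_upper) simp
  let ?r = "\<lambda>n. regularized_reduite W (\<phi> n)"
  have "incseq ?r"
    using assms(1) unfolding incseq_def by (blast intro: regularized_reduite_mono)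
  then have "(SUP n. ?r n) \<in> W"
    using B1[of ?r] regularized_reduite_in by blast
  moreover have "polar W (\<Union>n. {x. ?r n x < reduite W (\<phi> n) x})"
    by (intro polar_UN polar_regularized_reduite_less)
  moreover have "(SUP n. \<phi> n) x \<le> (SUP n. ?r n) x"
    if "x \<notin> (\<Union>n. {x. ?r n x < reduite W (\<phi> n) x})" for x
    unfolding SUP_apply using that by (intro SUP_mono' le_regularized_reduite) blast
  ultimately have "regularized_reduite W (SUP n. \<phi> n) \<le> (SUP n. ?r n)"
    by (rule regularized_reduite_le)
  also have "\<dots> \<le> (SUP n. reduite W (\<phi> n))"
    by (intro SUP_mono' regularized_reduite_le_reduite)
  finally have "regularized_reduite W (SUP n. \<phi> n) \<le> (SUP n. reduite W (\<phi> n))" .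
  moreover have "(SUP n. \<phi> n) \<le> (SUP n. reduite W (\<phi> n))"
    by (intro SUP_mono' le_reduite)
  moreover have "reduite W (SUP n. \<phi> n) = sup (SUP n. \<phi> n) (regularized_reduite W (SUP n. \<phi> n))"
  proof (rule reduite_eq)
    show "0 \<le> (SUP n. \<phi> n) x" for x
      unfolding SUP_apply by (rule SUP_upper2[of 0]) (simp_all add: assms(2))
  qed
  ultimately show "reduite W (SUP n. \<phi> n) \<le> (SUP n. reduite W (\<phi> n))"
    by simp
qed

text \<open>Choquet's theorem is applied to the capacity \<open>S \<mapsto> R(1\<^sub>S) x\<close> and \<open>A - {x}\<close>; removing \<open>x\<close> makes
  \<open>R(1\<^sub>L) x\<close> vanish for polar \<open>L \<subseteq> A - {x}\<close>.\<close>

lemma borel_polar_if_compact_polar: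
  assumes "A \<in> sets borel" and K: "\<And>K. compact K \<Longrightarrow> K \<subseteq> A \<Longrightarrow> polar W K"
  shows "polar W A"
proof (rule ccontr)
  assume "\<not> polar W A"
  let ?R = "\<lambda>S. reduite W (indicator S)"
  let ?r = "\<lambda>S. regularized_reduite W (indicator S)"
  \<comment> \<open>Otherwise \<open>?r A\<close> vanishes while \<open>?R A\<close> is at least 1
    on \<open>A\<close>, which puts \<open>A\<close> inside a polar set.\<close>
  have "\<exists>x. 0 < ?r A x"
  proof (rule ccontr)
    assume "\<not> ?thesis"
    then have r: "?r A x \<le> 0" for x by (simp add: not_less)
    have R: "1 \<le> ?R A x" if "x \<in> A" for x
      using le_funD[OF le_reduite[of "indicator A" W], of x] that by simp
    have "?r A x < ?R A x" if "x \<in> A" for x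
      by (rule le_less_trans[OF r less_le_trans[OF _ R[OF that]]]) simp
    then have "A \<subseteq> {x. ?r A x < ?R A x}" by blast
    then show False
      using polar_subset[OF polar_regularized_reduite_less] \<open>\<not> polar W A\<close> by blast
  qed
  then obtain x where "0 < ?r A x" by blast
  define B where "B = A - {x}"
  \<comment> \<open>If \<open>x \<in> A\<close>, the singleton \<open>{x}\<close> is a compact
    subset of \<open>A\<close>, hence polar, and its removal does not lower the regularized
    reduite.\<close>
  have "?r A \<le> ?r B"
  proof (rule regularized_reduite_le[OF regularized_reduite_in])
    have "polar W ({x} \<inter> A)"
      by (cases "x \<in> A") (simp_all add: polar_empty K)
    then show "polar W ({x} \<inter> A \<union> {y. ?r B y < ?R B y})"
      by (intro polar_Un polar_regularized_reduite_less)
    fix y assume y: "y \<notin> {x} \<inter> A \<union> {y. ?r B y < ?R B y}"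
    then have "indicator A y = (indicator B y :: ereal)" by (auto simp: B_def indicator_def)
    then show "indicator A y \<le> ?r B y" using le_regularized_reduite[of y "indicator B"] y by simp
  qed
  then have "0 < ?r B x" using \<open>0 < ?r A x\<close> by (meson le_funD less_le_trans)
  also have "\<dots> \<le> ?R B x" by (intro le_funD[OF regularized_reduite_le_reduite])
  finally obtain t where t: "0 < ereal t" "ereal t < ?R B x"
    using ereal_dense2 by blast
  have "analytic B"
    using assms(1) unfolding B_def by (intro borel_imp_analytic[OF locally_compact]) simp
  have ind_mono: "(indicator S :: 'a \<Rightarrow> ereal) \<le> indicator T" if "S \<subseteq> T" for S T
    using that by (auto simp: le_fun_def indicator_def)
  obtain L where L: "compact L" "L \<subseteq> B" "\<And>U. open U \<Longrightarrow> L \<subseteq> U \<Longrightarrow> ereal t < ?R U x"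
  proof (rule choquet_capacitability[of "\<lambda>S. ?R S x" B "ereal t"])
    show "?R S x \<le> ?R T x" if "S \<subseteq> T" for S T
      by (intro le_funD[OF reduite_mono] ind_mono that)
    fix S :: "nat \<Rightarrow> 'a set" assume "incseq S"
    have "(SUP n. indicator (S n)) = (indicator (\<Union>n. S n) :: 'a \<Rightarrow> ereal)"
    proof (rule antisym)
      show "(SUP n. indicator (S n)) \<le> (indicator (\<Union>n. S n) :: 'a \<Rightarrow> ereal)"
        by (intro SUP_least ind_mono) auto
      show "(indicator (\<Union>n. S n) :: 'a \<Rightarrow> ereal) \<le> (SUP n. indicator (S n))"
      proof (rule le_funI)
        fix y
        show "(indicator (\<Union>n. S n) y :: ereal) \<le> (SUP n. indicator (S n)) y"
        proof (cases "y \<in> (\<Union>n. S n)")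
          case True
          then obtain n where "y \<in> S n" by blast
          then show ?thesis unfolding SUP_apply by (intro SUP_upper2[of n]) (auto simp: indicator_def)
        next
          case False
          then show ?thesis unfolding SUP_apply by (intro SUP_upper2[of 0]) (auto simp: indicator_def)
        qed
      qed
    qed
    moreover have "incseq (\<lambda>n. indicator (S n) :: 'a \<Rightarrow> ereal)"
      using \<open>incseq S\<close> ind_mono by (simp add: incseq_def)
    ultimately show "?R (\<Union>n. S n) x = (SUP n. ?R (S n) x)"
      using reduite_SUP[of "\<lambda>n. indicator (S n)"] by (simp add: image_image)
  qed (use locally_compact \<open>analytic B\<close> t(2) in auto)
  have "x \<notin> L" using L(2) by (auto simp: B_def)
  have "?R L x \<le> 0"
    by (rule reduite_le_if_le_off_polar[OF zero_in K, of L])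
      (use L \<open>x \<notin> L\<close> in \<open>auto simp: B_def\<close>)
  then have "?R L x < ereal t" using t(1) by (rule le_less_trans)
  then obtain u where u: "u \<in> W" "indicator L \<le> u" "u x < ereal t"
    unfolding reduite_def Inf_apply INF_less_iff by blast
  obtain a where a: "u x = ereal a" "a < t"
    using u(3) nonneg[OF u(1), of x] by (cases "u x") auto
  obtain w where w: "w \<in> W" "\<And>x. 0 < w x" "\<And>x. w x < \<infinity>"
    by (rule pos_continuous) blast
  \<comment> \<open>Outer regularity: \<open>u\<close> is only at least 1 on \<open>L\<close>, so a
    multiple of \<open>w\<close> is added to make \<open>{1 < v}\<close> an open neighbourhood of
    \<open>L\<close>. Half of the gap \<open>t - a\<close> keeps \<open>v x\<close> below
    \<open>t\<close>.\<close>
  obtain c where c: "0 < c" "ereal c * w x \<le> ereal ((t - a) / 2)"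
    using scale_small[OF nonneg[OF w(1)] w(3), of "(t - a) / 2"] a by auto
  define v where "v = (\<lambda>y. u y + ereal c * w y)"
  have "v \<in> W" unfolding v_def using c by (intro cone_add cone_scale u w) simp
  define U where "U = {y. 1 < v y}"
  have "open U"
    using lsc[OF \<open>v \<in> W\<close>] unfolding lower_semicontinuous_def U_def by blast
  moreover have "L \<subseteq> U"
  proof
    fix y assume "y \<in> L"
    then have "1 \<le> u y" using le_funD[OF u(2), of y] by simp
    moreover have "0 < ereal c * w y" using c w(2)[of y] by (simp add: ereal_zero_less_0_iff)
    ultimately show "y \<in> U"
      unfolding U_def v_def by (cases "u y"; cases "ereal c * w y") (auto simp: one_ereal_def)
  qed
  ultimately have "ereal t < ?R U x" by (rule L)
  also have "\<dots> \<le> v x"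
    by (rule le_funD[OF reduite_le[OF \<open>v \<in> W\<close>]])
      (auto simp: le_fun_def indicator_def U_def nonneg[OF \<open>v \<in> W\<close>])
  also have "\<dots> \<le> ereal a + ereal ((t - a) / 2)"
    unfolding v_def a(1) by (intro add_left_mono c)
  also have "\<dots> < ereal t" using a(2) by (simp add: field_simps)
  finally show False .
qed

section \<open>Comparison with the upper semicontinuous minorants\<close>

lemma compact_polar_if_strictly_between:
  assumes "v \<in> W" and v: "\<And>\<psi>. \<psi> \<in> usc_minorants \<phi> \<Longrightarrow> regularized_reduite W \<psi> \<le> v"
    and \<phi>: "\<And>x. 0 \<le> \<phi> x" and K: "compact K" "\<And>x. x \<in> K \<Longrightarrow> v x < ereal q" "\<And>x. x \<in> K \<Longrightarrow> ereal q < \<phi> x"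
  shows "polar W K"
proof (cases "K = {}")
  case True
  then show ?thesis by (simp add: polar_empty)
next
  case False
  then obtain z where "z \<in> K" by blast
  have "0 < ereal q"
    by (rule le_less_trans[OF nonneg[OF \<open>v \<in> W\<close>] K(2)[OF \<open>z \<in> K\<close>]])
  define \<psi> where "\<psi> = (\<lambda>x. ereal q * indicator K x)"
  have "\<psi> \<in> usc_minorants \<phi>"
    unfolding \<psi>_def using \<open>0 < ereal q\<close> K \<phi>
    by (intro mult_indicator_usc_minorant) (auto intro: less_imp_le)
  then have le: "regularized_reduite W \<psi> x \<le> v x" for x
    using v by (simp add: le_funD)
  \<comment> \<open>On \<open>K\<close> the regularization stays below \<open>q\<close> because of
    \<open>v\<close>, while the reduite is at least \<open>q\<close>.\<close>
  have "K \<subseteq> {x. regularized_reduite W \<psi> x < reduite W \<psi> x}"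
  proof
    fix x assume "x \<in> K"
    have "regularized_reduite W \<psi> x < \<psi> x"
      using le_less_trans[OF le K(2)[OF \<open>x \<in> K\<close>]] \<open>x \<in> K\<close> by (simp add: \<psi>_def)
    also have "\<dots> \<le> reduite W \<psi> x" by (rule le_funD[OF le_reduite])
    finally show "x \<in> {x. regularized_reduite W \<psi> x < reduite W \<psi> x}" by simp
  qed
  with polar_regularized_reduite_less show ?thesis by (rule polar_subset)
qed

lemma regularized_reduite_le_if_usc_minorants_le:
  assumes "v \<in> W" and v: "\<And>\<psi>. \<psi> \<in> usc_minorants \<phi> \<Longrightarrow> regularized_reduite W \<psi> \<le> v"
    and \<phi>: "\<phi> \<in> borel_mod_polar W" "\<And>x. 0 \<le> \<phi> x"
  shows "regularized_reduite W \<phi> \<le> v"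
proof -
  obtain \<phi>1 \<phi>2 P where 1: "\<phi>1 \<in> borel_measurable borel" "\<phi>1 \<le> \<phi>" "\<phi> \<le> \<phi>2" "polar W P"
    "\<forall>x. x \<notin> P \<longrightarrow> \<phi>1 x = \<phi>2 x"
    using \<phi>(1) unfolding borel_mod_polar_def by blast
  have eq: "\<phi> x = \<phi>1 x" if "x \<notin> P" for x
    using le_funD[OF 1(2), of x] le_funD[OF 1(3), of x] 1(5) that by auto
  \<comment> \<open>Taking \<open>\<phi>1\<close> instead of \<open>\<phi>\<close> makes these sets
    Borel; since \<open>\<phi>1 \<le> \<phi>\<close>, their compact subsets still satisfy the strict
    inequality for \<open>\<phi>\<close>.\<close>
  define A where "A r = {x. v x < ereal (of_rat r) \<and> ereal (of_rat r) < \<phi>1 x}" for r :: rat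
  have v_meas: "v \<in> borel_measurable borel"
    using lsc[OF \<open>v \<in> W\<close>] unfolding lower_semicontinuous_def
    by (intro borel_measurableI_greater) simp
  have "polar W (A r)" for r
  proof (rule borel_polar_if_compact_polar)
    show "A r \<in> sets borel"
      unfolding A_def using v_meas 1(1) by measurable
    fix K assume "compact K" "K \<subseteq> A r"
    show "polar W K"
    proof (rule compact_polar_if_strictly_between[OF \<open>v \<in> W\<close> v \<phi>(2) \<open>compact K\<close>])
      fix x assume "x \<in> K"
      then show "v x < ereal (of_rat r)" using \<open>K \<subseteq> A r\<close> by (auto simp: A_def)
      have "ereal (of_rat r) < \<phi>1 x" using \<open>K \<subseteq> A r\<close> \<open>x \<in> K\<close> by (auto simp: A_def)
      then show "ereal (of_rat r) < \<phi> x" using le_funD[OF 1(2), of x] by (rule less_le_trans)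
    qed
  qed
  then have "polar W ((\<Union>r. A r) \<union> P)"
    by (intro polar_Un polar_UN 1)
  moreover have "\<phi> x \<le> v x" if "x \<notin> (\<Union>r. A r) \<union> P" for x
  proof (rule ccontr)
    assume "\<not> \<phi> x \<le> v x"
    then obtain r :: rat where "v x < real_of_rat r" "real_of_rat r < \<phi> x"
      using ereal_dense3 by (metis not_le)
    with eq[of x] that show False by (auto simp: A_def)
  qed
  ultimately show ?thesis by (rule regularized_reduite_le[OF \<open>v \<in> W\<close>])
qed

text \<open>Regularized reduites are lower semicontinuous, so countably many minorants already give
  the full supremum; the running maxima of an enumeration form the sequence.\<close>

lemma incseq_usc_minorants:
  assumes \<phi>: "\<And>x. 0 \<le> \<phi> x"
  obtains \<psi> where "incseq \<psi>" "\<And>n::nat. \<psi> n \<in> usc_minorants \<phi>"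
    "(SUP n. regularized_reduite W (\<psi> n)) = (SUP \<psi>\<in>usc_minorants \<phi>. regularized_reduite W \<psi>)"
proof -
  let ?r = "regularized_reduite W"
  obtain J where J: "J \<subseteq> usc_minorants \<phi>" "countable J"
    "(SUP \<psi>\<in>J. ?r \<psi>) = (SUP \<psi>\<in>usc_minorants \<phi>. ?r \<psi>)"
    using lsc_SUP_countable[of "usc_minorants \<phi>" ?r] lsc[OF regularized_reduite_in] by metis
  \<comment> \<open>The zero function guarantees a nonempty family to enumerate.\<close>
  let ?J = "insert (\<lambda>_. 0) J"
  have sub: "?J \<subseteq> usc_minorants \<phi>" using zero_usc_minorants[of \<phi>] \<phi> J(1) by simp
  define g where "g = from_nat_into ?J"
  have range_g: "range g = ?J" unfolding g_def using J(2) by (intro range_from_nat_into) auto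
  then have g: "g n \<in> usc_minorants \<phi>" for n using sub by blast
  define \<psi> where "\<psi> = rec_nat (g 0) (\<lambda>n f. sup f (g (Suc n)))"
  have \<psi>_rec: "\<psi> 0 = g 0" "\<psi> (Suc n) = sup (\<psi> n) (g (Suc n))" for n
    by (simp_all add: \<psi>_def)
  have "incseq \<psi>" by (intro incseq_SucI) (simp add: \<psi>_rec)
  moreover have \<psi>: "\<psi> n \<in> usc_minorants \<phi>" for n
  proof (induction n)
    case (Suc n)
    then show ?case unfolding \<psi>_rec using g by (rule sup_usc_minorants)
  qed (simp add: \<psi>_rec g)
  moreover have "(SUP n. ?r (\<psi> n)) = (SUP \<psi>\<in>usc_minorants \<phi>. ?r \<psi>)"
  proof (rule antisym)
    show "(SUP n. ?r (\<psi> n)) \<le> (SUP \<psi>\<in>usc_minorants \<phi>. ?r \<psi>)"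
      by (intro SUP_least SUP_upper \<psi>)
    have "g n \<le> \<psi> n" for n by (cases n) (simp_all add: \<psi>_rec)
    then have "?r f \<le> (SUP n. ?r (\<psi> n))" if "f \<in> ?J" for f
      using that unfolding range_g[symmetric] by (auto intro: SUP_upper2 regularized_reduite_mono)
    then show "(SUP \<psi>\<in>usc_minorants \<phi>. ?r \<psi>) \<le> (SUP n. ?r (\<psi> n))"
      unfolding J(3)[symmetric] by (intro SUP_least) blast
  qed
  ultimately show ?thesis by (rule that)
qed

end

theorem theorem2p2:
  fixes W :: "('a::{t2_space, second_countable_topology} \<Rightarrow> ereal) set"
    and \<phi> :: "'a \<Rightarrow> ereal"
  assumes "balayage_space W"
    and "axiom_of_polarity W"
    and "\<phi> \<in> borel_mod_polar W"
    and "\<And>x. 0 \<le> \<phi> x"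
  shows "\<exists>\<psi> :: nat \<Rightarrow> 'a \<Rightarrow> ereal.
      incseq \<psi> \<and> (\<forall>n. \<psi> n \<in> usc_minorants \<phi>) \<and>
      regularized_reduite W \<phi> = (SUP n. regularized_reduite W (\<psi> n)) \<and>
      reduite W \<phi> = sup \<phi> (SUP n. regularized_reduite W (\<psi> n)) \<and>
      reduite W \<phi> = sup \<phi> (SUP n. reduite W (\<psi> n)) \<and>
      reduite W \<phi> = (SUP \<psi>'\<in>usc_minorants \<phi>. reduite W \<psi>')"
proof -
  interpret polarity_balayage_space W
    using assms(1,2) by (simp add: polarity_balayage_space_def polarity_balayage_space_axioms_def)
  let ?r = "regularized_reduite W" and ?R = "reduite W"
  obtain \<psi> where \<psi>: "incseq \<psi>" "\<And>n::nat. \<psi> n \<in> usc_minorants \<phi>"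
    and SUP: "(SUP n. ?r (\<psi> n)) = (SUP \<psi>\<in>usc_minorants \<phi>. ?r \<psi>)"
    using incseq_usc_minorants[of \<phi>] assms(4) by blast
  have le: "f \<le> \<phi>" if "f \<in> usc_minorants \<phi>" for f
    using that by (simp add: usc_minorants_def)
  have r: "?r \<phi> = (SUP n. ?r (\<psi> n))"
  proof (rule antisym)
    show "(SUP n. ?r (\<psi> n)) \<le> ?r \<phi>"
      by (intro SUP_least regularized_reduite_mono le \<psi>)
    have "incseq (\<lambda>n. ?r (\<psi> n))"
      using \<psi>(1) unfolding incseq_def by (blast intro: regularized_reduite_mono)
    then have "(SUP n. ?r (\<psi> n)) \<in> W"
      by (intro B1 regularized_reduite_in)
    then show "?r \<phi> \<le> (SUP n. ?r (\<psi> n))"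
    proof (rule regularized_reduite_le_if_usc_minorants_le[OF _ _ assms(3,4)])
      fix f assume "f \<in> usc_minorants \<phi>"
      then show "?r f \<le> (SUP n. ?r (\<psi> n))" unfolding SUP by (rule SUP_upper)
    qed
  qed
  have R: "?R \<phi> = sup \<phi> (SUP n. ?r (\<psi> n))"
    unfolding r[symmetric] using assms(4) by (rule reduite_eq)
  have R': "?R \<phi> = sup \<phi> (SUP n. ?R (\<psi> n))"
  proof (rule antisym)
    show "?R \<phi> \<le> sup \<phi> (SUP n. ?R (\<psi> n))"
      unfolding R by (intro sup_mono order_refl SUP_mono' regularized_reduite_le_reduite)
    show "sup \<phi> (SUP n. ?R (\<psi> n)) \<le> ?R \<phi>"
      by (intro sup_least SUP_least le_reduite reduite_mono le \<psi>)
  qed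
  \<comment> \<open>Each level \<open>q\<close> below \<open>\<phi> x\<close> is reached by the
    minorant supported at the single point \<open>x\<close>. It is a minorant for
    \<open>q > 0\<close>; for other \<open>q\<close> the zero function suffices.\<close>
  have "\<phi> x \<le> (SUP f\<in>usc_minorants \<phi>. ?R f) x" for x
  proof (rule dense_le)
    fix y assume "y < \<phi> x"
    then obtain q where q: "y < ereal q" "ereal q < \<phi> x" using ereal_dense2 by blast
    show "y \<le> (SUP f\<in>usc_minorants \<phi>. ?R f) x"
    proof (cases "0 < q")
      case True
      let ?f = "\<lambda>z. ereal q * indicator {x} z"
      have "y \<le> ?f x" using q(1) by simp
      also have "\<dots> \<le> ?R ?f x" by (rule le_funD[OF le_reduite])
      also have "\<dots> \<le> (SUP f\<in>usc_minorants \<phi>. ?R f) x"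
        using True q(2) assms(4)
        by (intro le_funD[OF SUP_upper] mult_indicator_usc_minorant) auto
      finally show ?thesis .
    next
      case False
      then have "ereal q \<le> 0" by simp
      then have "y \<le> 0" by (rule order_trans[OF less_imp_le[OF q(1)]])
      also have "\<dots> \<le> ?R (\<lambda>_. 0) x" by (rule le_funD[OF le_reduite])
      also have "\<dots> \<le> (SUP f\<in>usc_minorants \<phi>. ?R f) x"
        using assms(4) by (intro le_funD[OF SUP_upper] zero_usc_minorants)
      finally show ?thesis .
    qed
  qed
  then have "\<phi> \<le> (SUP f\<in>usc_minorants \<phi>. ?R f)" by (rule le_funI)
  moreover have "(SUP n. ?R (\<psi> n)) \<le> (SUP f\<in>usc_minorants \<phi>. ?R f)"
    by (intro SUP_least SUP_upper \<psi>)
  ultimately have "?R \<phi> \<le> (SUP f\<in>usc_minorants \<phi>. ?R f)"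
    unfolding R' by simp
  moreover have "(SUP f\<in>usc_minorants \<phi>. ?R f) \<le> ?R \<phi>"
    by (intro SUP_least reduite_mono le)
  ultimately have "?R \<phi> = (SUP f\<in>usc_minorants \<phi>. ?R f)" by (rule antisym)
  with \<psi> r R R' show ?thesis by blast
qed

end
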